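(* Let $(\Omega,S)$ be a 4-equivalenced association scheme with $|S|\ge 4$. If $\tau\in\mathrm{Aut}(\Omega,S)$ fixes two distinct points of $\Omega$, then $\tau$ is the identity map.
   Context: An association scheme $(\Omega,S)$: $\Omega$ finite, $S$ a partition of $\Omega\times\Omega$ containing $1_\Omega$, closed under transposition, with intersection numbers $c_{st}^r=|\{z:(x,z)\in s,(z,y)\in t\}|$ independent of $(x,y)\in r$; it is 4-equivalenced if every $s\neq1_\Omega$ has valency $c_{ss^*}^{1_\Omega}=4$. $\mathrm{Aut}(\Omega,S)=\{\sigma\in\mathrm{Sym}(\Omega):\mathrm{r}(\alpha,\beta)=\mathrm{r}(\alpha^\sigma,\beta^\sigma)\ \forall\alpha,\beta\}$, where $\mathrm{r}(\alpha,\beta)$ is the element of $S$ containing $(\alpha,\beta)$. *)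

theory Defs
  imports "HOL-Library.Disjoint_Sets" "HOL-Combinatorics.Permutations"
begin

definition triangles ::
    "'a set \<Rightarrow> ('a \<times> 'a) set \<Rightarrow> ('a \<times> 'a) set \<Rightarrow> 'a \<Rightarrow> 'a \<Rightarrow> nat" where
  "triangles \<Omega> s t x y = card {z \<in> \<Omega>. (x, z) \<in> s \<and> (z, y) \<in> t}"

text \<open>The classes of a \<^const>\<open>partition_on\<close> are nonempty, so \<open>Id_on \<Omega> \<in> S\<close>
  makes \<open>\<Omega>\<close> nonempty. Commutativity of the scheme is not required.\<close>

locale association_scheme =
  fixes \<Omega> :: "'a set" and S :: "('a \<times> 'a) set set"
  assumes finite_points: "finite \<Omega>"
    and partition: "partition_on (\<Omega> \<times> \<Omega>) S"
    and diagonal: "Id_on \<Omega> \<in> S"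
    and transpose: "\<And>s. s \<in> S \<Longrightarrow> s\<inverse> \<in> S"
    and regular: "\<And>r s t. \<lbrakk>r \<in> S; s \<in> S; t \<in> S\<rbrakk> \<Longrightarrow>
      \<exists>c. \<forall>(x, y) \<in> r. triangles \<Omega> s t x y = c"

text \<open>\<open>intersection_number \<Omega> s t r\<close> is \<open>c\<^sub>s\<^sub>t\<^sup>r\<close>; in a scheme it is well defined,
  since \<open>r\<close> is nonempty and the count is constant on \<open>r\<close>.\<close>

definition intersection_number ::
    "'a set \<Rightarrow> ('a \<times> 'a) set \<Rightarrow> ('a \<times> 'a) set \<Rightarrow> ('a \<times> 'a) set \<Rightarrow> nat" where
  "intersection_number \<Omega> s t r = (THE c. \<forall>(x, y) \<in> r. triangles \<Omega> s t x y = c)"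

definition valency :: "'a set \<Rightarrow> ('a \<times> 'a) set \<Rightarrow> nat" where
  "valency \<Omega> s = intersection_number \<Omega> s (s\<inverse>) (Id_on \<Omega>)"

definition equivalenced :: "nat \<Rightarrow> 'a set \<Rightarrow> ('a \<times> 'a) set set \<Rightarrow> bool" where
  "equivalenced k \<Omega> S \<longleftrightarrow> (\<forall>s \<in> S. s \<noteq> Id_on \<Omega> \<longrightarrow> valency \<Omega> s = k)"

definition class_of :: "('a \<times> 'a) set set \<Rightarrow> 'a \<Rightarrow> 'a \<Rightarrow> ('a \<times> 'a) set" where
  "class_of S \<alpha> \<beta> = (THE s. s \<in> S \<and> (\<alpha>, \<beta>) \<in> s)"

text \<open>\<open>Sym(\<Omega>)\<close> is rendered by \<^const>\<open>permutes\<close>, so automorphisms are extended by the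
  identity outside \<open>\<Omega>\<close>.\<close>

definition Aut :: "'a set \<Rightarrow> ('a \<times> 'a) set set \<Rightarrow> ('a \<Rightarrow> 'a) set" where
  "Aut \<Omega> S = {\<sigma>. \<sigma> permutes \<Omega> \<and>
     (\<forall>\<alpha> \<in> \<Omega>. \<forall>\<beta> \<in> \<Omega>. class_of S \<alpha> \<beta> = class_of S (\<sigma> \<alpha>) (\<sigma> \<beta>))}"

end

theory Submission
  imports Defs Complex_Main
begin

text \<open>Let \<open>w s v\<close> be the coefficient of a class \<open>v \<noteq> 1\<close> in \<open>s s\<^sup>*\<close>, so that each row
  \<open>w s\<close> sums to 3. The coefficients of \<open>q\<^sup>* s\<close> (\<open>q \<noteq> s\<close>) sum to 4 and their squares to
  \<open>4 + \<langle>w q, w s\<rangle>\<close>; hence \<open>\<langle>w q, w s\<rangle>\<close> is even. Together with two local observations this parity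
  condition forces every column sum \<open>\<Sum>q. w q v\<close> to be at most 3.

  Let an automorphism \<open>\<tau> \<noteq> id\<close> fix two points \<open>x\<close>, \<open>y\<close> and put \<open>s = r x y\<close>. If \<open>\<tau>\<close> moves \<open>z\<close>,
  every fixed point is in the same relation to \<open>z\<close> and \<open>\<tau> z\<close>, so a column sum bounds the number
  of fixed points by 3. Therefore \<open>\<tau>\<close> moves at least three of the four \<open>q\<close>-neighbours of \<open>x\<close> for
  each \<open>q \<noteq> s\<close>, and \<open>a\<close>, \<open>\<tau> a\<close> are always in the same relation to \<open>y\<close>; this gives
  \<open>\<langle>w q, w s\<rangle> \<ge> 4\<close>. Summing over \<open>q\<close> yields at least \<open>3 + 4 + 4\<close>, whereas the column sums bound
  the total by \<open>3 \<cdot> 3\<close>.\<close>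

section \<open>Double counting over finite sets\<close>

lemma sum_group_card:
  fixes f :: "'b \<Rightarrow> nat"
  assumes "finite A" "finite M" "g ` A \<subseteq> M"
  shows "(\<Sum>y\<in>A. f (g y)) = (\<Sum>v\<in>M. card {y \<in> A. g y = v} * f v)"
proof -
  have "(\<Sum>y\<in>A. f (g y)) = (\<Sum>v\<in>M. \<Sum>y | y \<in> A \<and> g y = v. f (g y))"
    using sum.group[OF assms, of "\<lambda>y. f (g y)"] by simp
  also have "\<dots> = (\<Sum>v\<in>M. card {y \<in> A. g y = v} * f v)"
    by (intro sum.cong) auto
  finally show ?thesis .
qed

lemma sum_card_swap:
  assumes "finite A" "finite B"
  shows "(\<Sum>x\<in>A. card {y \<in> B. R x y}) = (\<Sum>y\<in>B. card {x \<in> A. R x y})"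
  using sum.swap_restrict[OF assms, of "\<lambda>_ _. 1 :: nat" R] by simp

section \<open>Triples with even pairwise intersections\<close>

lemma three_le_sum_inverse:
  fixes p :: "'b \<Rightarrow> nat"
  assumes "card X = 3" "\<And>x. x \<in> X \<Longrightarrow> 1 \<le> p x \<and> p x \<le> 3"
  shows "1 \<le> (\<Sum>x\<in>X. 1 / real (p x))"
proof -
  have "(\<Sum>x\<in>X. 1 / (3::real)) \<le> (\<Sum>x\<in>X. 1 / real (p x))"
    using assms(2) by (intro sum_mono divide_left_mono) force+
  then show ?thesis using assms(1) by simp
qed

text \<open>If some point lies on four of the triples, each triple through it has a private point, so
  \<open>\<Sum>x\<in>X q. 1 / deg x\<close> is at least 1 for all triples and exceeds 1 for some; but these sums add up
  to at most the number of points, which is the number of triples.\<close>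

lemma triples_even_intersections:
  fixes X :: "'b \<Rightarrow> 'b set"
  assumes fin: "finite T"
    and sub: "\<And>q. q \<in> T \<Longrightarrow> X q \<subseteq> T"
    and card3: "\<And>q. q \<in> T \<Longrightarrow> card (X q) = 3"
    and ev: "\<And>q q'. \<lbrakk>q \<in> T; q' \<in> T; q \<noteq> q'\<rbrakk> \<Longrightarrow> even (card (X q \<inter> X q'))"
    and z: "z \<in> T"
  shows "card {q \<in> T. z \<in> X q} \<le> 3"
proof (rule ccontr)
  define p where "p a = card {q \<in> T. a \<in> X q}" for a
  assume "\<not> ?thesis"
  then have pz: "p z \<ge> 4" by (simp add: p_def)
  have finX: "finite (X q)" if "q \<in> T" for q
    using card3[OF that] by (simp add: card_ge_0_finite)
  have meet: "card (X q \<inter> X q') = 2" if "q \<in> T" "q' \<in> T" "q \<noteq> q'" "a \<in> X q" "a \<in> X q'" for q q' a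
  proof -
    have "card (X q \<inter> X q') \<le> 3"
      using card_mono[OF finX[OF that(1)], of "X q \<inter> X q'"] card3[OF that(1)] by simp
    moreover have "card (X q \<inter> X q') \<noteq> 0"
      using that finX[OF that(1)] by auto
    moreover have "even (card (X q \<inter> X q'))" using ev that by blast
    ultimately have "card (X q \<inter> X q') \<in> {1,2,3}" "even (card (X q \<inter> X q'))" by auto
    then show ?thesis by auto
  qed
  have other: "\<exists>d. d \<notin> {a,b,c} \<and> (X q' = {a,b,d} \<or> X q' = {a,c,d})"
    if "q \<in> T" "q' \<in> T" "q \<noteq> q'" "X q = {a,b,c}" "a \<in> X q'" for q q' a b c
  proof -
    have abc: "a \<noteq> b" "a \<noteq> c" "b \<noteq> c"
      using card3[OF that(1)] that(4) by (auto simp: card_insert_if split: if_splits)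
    have two: "card ({a,b,c} \<inter> X q') = 2" using meet[OF that(1-3), of a] that(4,5) by simp
    have "card (X q' - {a,b,c}) = 1"
      using card_Diff_subset_Int[of "X q'" "{a,b,c}"] two card3[OF that(2)] by (simp add: Int_commute)
    then obtain d where d: "X q' - {a,b,c} = {d}" by (rule card_1_singletonE)
    have "b \<in> X q' \<and> c \<notin> X q' \<or> b \<notin> X q' \<and> c \<in> X q'"
    proof (rule ccontr)
      assume "\<not> ?thesis"
      then have "{a,b,c} \<inter> X q' = {a,b,c} \<or> {a,b,c} \<inter> X q' = {a}" using that(5) by blast
      then show False using two abc by auto
    qed
    then have "X q' = {a,b,d} \<or> X q' = {a,c,d}" using d that(5) by blast
    moreover have "d \<notin> {a,b,c}" using d by blast
    ultimately show ?thesis by blast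
  qed
  \<comment> \<open>If every triple through \<open>a\<close> contains \<open>b\<close>, a second
    triple through \<open>c\<close> must avoid \<open>a\<close> and so has the form
    \<open>{c, b, f}\<close>. Meeting it in two points forces every further triple through
    \<open>a\<close> to be \<open>{a, b, f}\<close>. Two such triples would meet in 3 points, an odd
    number, so \<open>a\<close> has degree at most 2.\<close>
  have star: "p c = 1"
    if q: "q \<in> T" "X q = {a,b,c}" and pa: "p a \<ge> 4"
      and all: "\<And>q'. \<lbrakk>q' \<in> T; a \<in> X q'\<rbrakk> \<Longrightarrow> b \<in> X q'" for q a b c
  proof -
    have abc: "a \<noteq> b" "a \<noteq> c" "b \<noteq> c"
      using card3[OF q(1)] q(2) by (auto simp: card_insert_if split: if_splits)
    have third: "\<exists>d. d \<notin> {a,b,c} \<and> X q' = {a,b,d}"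
      if "q' \<in> T" "a \<in> X q'" "q' \<noteq> q" for q'
      using other[OF q(1) that(1) that(3)[symmetric] q(2) that(2)] all[OF that(1,2)] abc by auto
    have "q' = q" if q': "q' \<in> T" "c \<in> X q'" for q'
    proof (rule ccontr)
      assume ne: "q' \<noteq> q"
      have "a \<notin> X q'" using third[OF q'(1) _ ne] q'(2) abc by auto
      obtain f where f: "f \<notin> {a,b,c}" "X q' = {c,b,f}"
        using other[OF q(1) q'(1) ne[symmetric], of c b a] q q'(2) \<open>a \<notin> X q'\<close> by auto
      have "X u = {a,b,f}" if u: "u \<in> T" "a \<in> X u" "u \<noteq> q" for u
      proof -
        obtain d where d: "d \<notin> {a,b,c}" "X u = {a,b,d}" using third[OF u] by blast
        have "u \<noteq> q'" using u(2) \<open>a \<notin> X q'\<close> by blast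
        then have "card ({a,b,d} \<inter> {c,b,f}) = 2"
          using meet[OF u(1) q'(1), of b] d f by simp
        moreover have "{a,b,d} \<inter> {c,b,f} = {b}" if "d \<noteq> f" using that d(1) f(1) abc by blast
        ultimately have "d = f" by (metis card_1_singleton_iff n_not_Suc_n numeral_2_eq_2)
        then show ?thesis using d by simp
      qed
      then have "u = u'" if "u \<in> T" "a \<in> X u" "u \<noteq> q" "u' \<in> T" "a \<in> X u'" "u' \<noteq> q" for u u'
        using that ev[of u u'] card3[of u] by (metis Int_absorb odd_numeral)
      then have "card ({u \<in> T. a \<in> X u} - {q}) \<le> 1"
        by (auto simp: card_le_Suc0_iff_eq fin)
      then show False using pa fin by (auto simp: p_def card_Diff_singleton_if split: if_splits)
    qed
    then have "{q' \<in> T. c \<in> X q'} = {q}" using q(1) q(2) by blast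
    then show ?thesis by (simp add: p_def)
  qed
  have own: "\<exists>c\<in>X q. c \<noteq> a \<and> p c = 1" if q: "q \<in> T" "a \<in> X q" and pa: "p a \<ge> 4" for q a
  proof -
    have "card (X q - {a}) = 2" using card3[OF q(1)] q(2) by (simp add: card_Diff_singleton)
    then obtain b c where bc: "X q - {a} = {b,c}" "b \<noteq> c" by (meson card_2_iff)
    have X: "X q = {a,b,c}" "X q = {a,c,b}" using bc q(2) by auto
    show ?thesis
    proof (cases "(\<forall>q'\<in>T. a \<in> X q' \<longrightarrow> b \<in> X q') \<or> (\<forall>q'\<in>T. a \<in> X q' \<longrightarrow> c \<in> X q')")
      case True
      then show ?thesis using star[OF q(1) X(1) pa] star[OF q(1) X(2) pa] bc by blast
    next
      case False
      \<comment> \<open>Since all these intersections have size 2, the triple \<open>u\<close>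
        missing \<open>b\<close> and the triple \<open>u'\<close> missing \<open>c\<close> share
        their point outside \<open>{a, b, c}\<close>, and no triple besides \<open>q\<close>,
        \<open>u\<close>, \<open>u'\<close> passes through \<open>a\<close>: its degree is at most
        3.\<close>
      then obtain u u' where u: "u \<in> T" "a \<in> X u" "b \<notin> X u" "u' \<in> T" "a \<in> X u'" "c \<notin> X u'" by blast
      have ne: "u \<noteq> q" "u' \<noteq> q" using u X by auto
      obtain d where d: "d \<notin> {a,b,c}" "X u = {a,c,d}"
        using other[OF q(1) u(1) ne(1)[symmetric] X(1) u(2)] u(3) by auto
      obtain e where e: "e \<notin> {a,b,c}" "X u' = {a,b,e}"
        using other[OF q(1) u(4) ne(2)[symmetric] X(1) u(5)] u(6) by auto
      have abc: "a \<noteq> b" "a \<noteq> c" "b \<noteq> c" using bc by auto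
      have same: "y = d" if "y \<notin> {a,b,c}" "X v = {a,b,y}" "v \<in> T" for v y
      proof -
        have "v \<noteq> u" using that u by auto
        then have "card ({a,b,y} \<inter> {a,c,d}) = 2"
          using meet[OF that(3) u(1), of a] that(2) d by simp
        moreover have "{a,b,y} \<inter> {a,c,d} = {a}" if "y \<noteq> d" using that \<open>y \<notin> _\<close> d(1) abc by blast
        ultimately show ?thesis by (metis card_1_singleton_iff n_not_Suc_n numeral_2_eq_2)
      qed
      have same': "y = e" if "y \<notin> {a,b,c}" "X v = {a,c,y}" "v \<in> T" for v y
      proof -
        have "v \<noteq> u'" using that u by auto
        then have "card ({a,c,y} \<inter> {a,b,e}) = 2"
          using meet[OF that(3) u(4), of a] that(2) e by simp
        moreover have "{a,c,y} \<inter> {a,b,e} = {a}" if "y \<noteq> e" using that \<open>y \<notin> _\<close> e(1) abc by blast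
        ultimately show ?thesis by (metis card_1_singleton_iff n_not_Suc_n numeral_2_eq_2)
      qed
      have de: "e = d" using same[OF e u(4)] .
      have inj: "v = v'" if "v \<in> T" "v' \<in> T" "X v = X v'" for v v'
        using that ev[of v v'] card3[of v] by (metis Int_absorb odd_numeral)
      have "v \<in> {q,u,u'}" if v: "v \<in> T" "a \<in> X v" for v
      proof (cases "v = q")
        case False
        then obtain y where "y \<notin> {a,b,c}" "X v = {a,b,y} \<or> X v = {a,c,y}"
          using other[OF q(1) v(1) _ X(1) v(2)] by blast
        then have "X v = X u \<or> X v = X u'" using same same' v(1) d e de by metis
        then show ?thesis using inj v u by blast
      qed simp
      then have "p a \<le> card {q,u,u'}" unfolding p_def by (intro card_mono) auto
      also have "\<dots> \<le> 3" by (simp add: card_insert_if)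
      finally show ?thesis using pa by simp
    qed
  qed
  have pos: "1 \<le> p a" if "q \<in> T" "a \<in> X q" for q a
    using that fin by (auto simp: p_def Suc_le_eq card_gt_0_iff)
  have big: "1 < (\<Sum>x\<in>X q. 1 / real (p x))" if q: "q \<in> T" "a \<in> X q" and pa: "p a \<ge> 4" for q a
  proof -
    obtain c where c: "c \<in> X q" "c \<noteq> a" "p c = 1" using own[OF q pa] by blast
    \<comment> \<open>The private point \<open>c\<close> alone contributes 1, and \<open>a\<close>
      adds a positive amount.\<close>
    have "(\<Sum>x\<in>{a,c}. 1 / real (p x)) \<le> (\<Sum>x\<in>X q. 1 / real (p x))"
      using c q finX[OF q(1)] by (intro sum_mono2) auto
    moreover have "(\<Sum>x\<in>{a,c}. 1 / real (p x)) > 1" using c pa by simp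
    ultimately show ?thesis by linarith
  qed
  have ge1: "1 \<le> (\<Sum>x\<in>X q. 1 / real (p x))" if "q \<in> T" for q
  proof (cases "\<exists>a\<in>X q. p a \<ge> 4")
    case True
    then show ?thesis using big[OF that] by force
  next
    case False
    then show ?thesis using three_le_sum_inverse[OF card3[OF that], of p] pos[OF that] by force
  qed
  obtain q0 where q0: "q0 \<in> T" "z \<in> X q0"
    using pz unfolding p_def by (metis (mono_tags, lifting) Collect_empty_eq card.empty not_numeral_le_zero)
  have "real (card T) = (\<Sum>q\<in>T. 1)" by simp
  also have "\<dots> < (\<Sum>q\<in>T. \<Sum>x\<in>X q. 1 / real (p x))"
    using ge1 big[OF q0 pz] q0(1) fin by (intro sum_strict_mono_ex1) auto
  also have "\<dots> = (\<Sum>q\<in>T. \<Sum>x | x \<in> T \<and> x \<in> X q. 1 / real (p x))"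
    using sub by (intro sum.cong) auto
  also have "\<dots> = (\<Sum>x\<in>T. \<Sum>q | q \<in> T \<and> x \<in> X q. 1 / real (p x))"
    by (rule sum.swap_restrict[OF fin fin])
  also have "\<dots> = (\<Sum>x\<in>T. real (p x) * (1 / real (p x)))" by (simp add: p_def)
  \<comment> \<open>Only an inequality: a point on no triple contributes
    \<open>0 * (1 / 0) = 0\<close>.\<close>
  also have "\<dots> \<le> (\<Sum>x\<in>T. 1)" by (intro sum_mono) simp
  finally show False by simp
qed

section \<open>Column sums of a weight matrix with even row products\<close>

text \<open>Rows of shape \<open>(2, 1)\<close>: the position \<open>\<phi> s\<close> of the entry 2 defines an injection of the set
  \<open>D\<close> of these rows into itself, hence a permutation, and the entry 1 sits at \<open>\<phi> (\<phi> s)\<close>. Rows of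
  shape \<open>(1, 1, 1)\<close> are, by parity, supported on such rows only.\<close>

lemma weights_column_sum_le:
  fixes w :: "'b \<Rightarrow> 'b \<Rightarrow> nat"
  assumes fin: "finite N"
    and sum3: "\<And>s. s \<in> N \<Longrightarrow> (\<Sum>v\<in>N. w s v) = 3"
    and ev: "\<And>s t. \<lbrakk>s \<in> N; t \<in> N; s \<noteq> t\<rbrakk> \<Longrightarrow> even (\<Sum>v\<in>N. w s v * w t v)"
    and heavy: "\<And>s u. \<lbrakk>s \<in> N; u \<in> N; w s u = 3\<rbrakk> \<Longrightarrow> u = s"
    and double: "\<And>s u v. \<lbrakk>s \<in> N; u \<in> N; v \<in> N; w s u = 2; w s v = 1\<rbrakk> \<Longrightarrow> w u v = 2"
    and v: "v \<in> N"
  shows "(\<Sum>s\<in>N. w s v) \<le> 3"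
proof -
  have le3: "w s u \<le> 3" if "s \<in> N" "u \<in> N" for s u
    using member_le_sum[of u N "w s"] sum3[OF that(1)] that fin by simp
  have rest: "(\<Sum>x\<in>N - {u}. w s x) = 3 - w s u" if "s \<in> N" "u \<in> N" for s u
    using sum.remove[OF fin that(2), of "w s"] sum3[OF that(1)] by simp
  have shape3: "w s x = 0" if "s \<in> N" "w s u = 3" "u \<in> N" "x \<in> N" "x \<noteq> u" for s u x
    using rest[OF that(1,3)] that fin by simp
  have shape2: "\<exists>y\<in>N. y \<noteq> u \<and> w s y = 1 \<and> (\<forall>x\<in>N - {u,y}. w s x = 0)"
    if "s \<in> N" "w s u = 2" "u \<in> N" for s u
  proof -
    have "(\<Sum>x\<in>N - {u}. w s x) = 1" using rest[OF that(1,3)] that(2) by simp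
    then obtain y where "y \<in> N - {u}" "w s y = 1" "\<forall>x\<in>N - {u}. y \<noteq> x \<longrightarrow> w s x = 0"
      using fin sum_eq_1_iff[of "N - {u}" "w s"] by auto
    then show ?thesis by (intro bexI[of _ y]) auto
  qed
  have sum_shape2: "(\<Sum>x\<in>N. w s x * f x) = 2 * f u + f y"
    if s: "s \<in> N" "w s u = 2" "u \<in> N" "w s y = 1" "y \<in> N" for s u y f
  proof -
    obtain y' where y': "y' \<in> N" "y' \<noteq> u" "w s y' = 1" "\<forall>x\<in>N - {u,y'}. w s x = 0"
      using shape2[OF s(1-3)] by blast
    have yy: "y = y'" using y' s by force
    have "(\<Sum>x\<in>N. w s x * f x) = (\<Sum>x\<in>{u,y}. w s x * f x)"
      using fin y' s yy by (intro sum.mono_neutral_right) auto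
    then show ?thesis using s y' yy by simp
  qed
  have sum_shape3: "(\<Sum>x\<in>N. w s x * f x) = 3 * f s" if "s \<in> N" "w s u = 3" "u \<in> N" for s u f
  proof -
    have us: "u = s" using heavy that by blast
    have "(\<Sum>x\<in>N. w s x * f x) = (\<Sum>x\<in>{s}. w s x * f x)"
      using fin that us shape3[OF that(1,2,3)] by (intro sum.mono_neutral_right) auto
    then show ?thesis using that us by simp
  qed
  define D where "D = {s \<in> N. \<exists>u\<in>N. w s u = 2}"
  define \<phi> where "\<phi> s = (SOME u. u \<in> N \<and> w s u = 2)" for s
  have \<phi>: "\<phi> s \<in> N" "w s (\<phi> s) = 2" if "s \<in> D" for s
    using that someI_ex[of "\<lambda>u. u \<in> N \<and> w s u = 2"] by (auto simp: D_def \<phi>_def)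
  have \<phi>_unique: "u = \<phi> s" if "s \<in> N" "u \<in> N" "w s u = 2" for s u
  proof -
    have "s \<in> D" using that by (auto simp: D_def)
    from shape2[OF that(1) \<phi>(2,1)[OF this]] show ?thesis using that by force
  qed
  \<comment> \<open>Rows \<open>s\<close> and \<open>t\<close> with the 2 in the same position also
    agree in the position of the 1, because \<open>double\<close> puts the 2 of row
    \<open>\<phi> s\<close> at both. Their product is then 2 * 2 + 1 = 5, which is odd.\<close>
  have inj: "inj_on \<phi> D"
  proof (rule inj_onI, rule ccontr)
    fix s t assume st: "s \<in> D" "t \<in> D" "\<phi> s = \<phi> t" "s \<noteq> t"
    have N: "s \<in> N" "t \<in> N" using st by (auto simp: D_def)
    obtain y where y: "y \<in> N" "w s y = 1" using shape2[OF N(1) \<phi>(2,1)[OF st(1)]] by blast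
    obtain y' where y': "y' \<in> N" "w t y' = 1" using shape2[OF N(2) \<phi>(2,1)[OF st(2)]] by blast
    have "w (\<phi> s) y = 2" using double[OF N(1) \<phi>(1)[OF st(1)] y(1) \<phi>(2)[OF st(1)] y(2)] .
    moreover have "w (\<phi> s) y' = 2"
      using double[OF N(2) \<phi>(1)[OF st(2)] y'(1) \<phi>(2)[OF st(2)] y'(2)] st(3) by simp
    ultimately have "y = y'" using \<phi>_unique \<phi>(1)[OF st(1)] y(1) y'(1) by metis
    then have "(\<Sum>x\<in>N. w s x * w t x) = 5"
      using sum_shape2[OF N(1) \<phi>(2,1)[OF st(1)] y(2,1), of "w t"] \<phi>(2)[OF st(2)] st(3) y' by simp
    then show False using ev[OF N st(4)] by simp
  qed
  have \<phi>_D: "\<phi> s \<in> D" if sD: "s \<in> D" for s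
  proof -
    have sN: "s \<in> N" using sD by (auto simp: D_def)
    then obtain y where "y \<in> N" "w s y = 1" using shape2 \<phi>[OF sD] by blast
    then show ?thesis using double \<phi>[OF sD] sN unfolding D_def by blast
  qed
  have surj: "\<phi> ` D = D"
    using endo_inj_surj[of D \<phi>] fin inj \<phi>_D by (auto simp: D_def)
  \<comment> \<open>Two steps back along the permutation \<open>\<phi>\<close>:
    \<open>u = \<phi> t\<close> and \<open>a = \<phi> u\<close>, and the 1 of row \<open>t\<close>
    lies at \<open>a\<close>.\<close>
  have pre2: "\<exists>t\<in>N. \<exists>u\<in>N. w t u = 2 \<and> w t a = 1 \<and> w u a = 2" if aD: "a \<in> D" for a
  proof -
    obtain u where u: "u \<in> D" "a = \<phi> u" using surj aD by blast
    obtain t where t: "t \<in> D" "u = \<phi> t" using surj u by blast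
    have tN: "t \<in> N" "u \<in> N" using t u by (auto simp: D_def)
    obtain y where y: "y \<in> N" "w t y = 1" using shape2 \<phi>[OF t(1)] tN by blast
    have "w u y = 2" using double[OF tN(1) tN(2) y(1)] \<phi>[OF t(1)] t y by simp
    then have "y = a" using \<phi>_unique tN y u by blast
    then show ?thesis using tN y \<phi>[OF t(1)] \<open>w u y = 2\<close> t by blast
  qed
  \<comment> \<open>Cases by the largest entry of column \<open>v\<close>.\<close>
  consider (three) s where "s \<in> N" "w s v = 3"
    | (two) s where "s \<in> N" "w s v = 2" "\<forall>t\<in>N. w t v \<noteq> 3"
    | (one) "\<forall>s\<in>N. w s v \<le> 1"
    using le3[OF _ v] by (metis One_nat_def Suc_1 le_SucE le_zero_eq numeral_3_eq_3 not_less_eq_eq nle_le)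
  then show ?thesis
  proof cases
    case three
    then have v3: "w v v = 3" using heavy v by blast
    have "w t v = 0" if t: "t \<in> N" "t \<noteq> v" for t
    proof -
      have "even (3 * w t v)" using ev[OF v t(1)] t(2) sum_shape3[OF v v3 v, of "w t"] by simp
      moreover have "w t v \<noteq> 3" using heavy t v by blast
      \<comment> \<open>A 2 here would, by \<open>double\<close>, put a 2 into row \<open>v\<close>
        away from its single entry 3.\<close>
      moreover have "w t v \<noteq> 2"
      proof
        assume 2: "w t v = 2"
        then obtain y where y: "y \<in> N" "y \<noteq> v" "w t y = 1" using shape2 t v by blast
        then show False using double[OF t(1) v y(1) 2 y(3)] shape3[OF v v3 v y(1,2)] by simp
      qed
      moreover have "w t v \<le> 3" using le3 t v by blast
      ultimately have "w t v \<in> {0,1,2,3}" "even (3 * w t v)" "w t v \<noteq> 3" "w t v \<noteq> 2" by auto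
      then show ?thesis by auto
    qed
    then have "(\<Sum>s\<in>N. w s v) = (\<Sum>s\<in>{v}. w s v)" using fin v by (intro sum.mono_neutral_right) auto
    then show ?thesis using v3 by simp
  next
    case two
    have s: "s \<in> D" "\<phi> s = v" using two(1,2) v \<phi>_unique by (auto simp: D_def)
    then have "v \<in> D" using \<phi>_D by blast
    then obtain t u where t: "t \<in> N" "u \<in> N" "w t u = 2" "w t v = 1" using pre2 by blast
    \<comment> \<open>Only row \<open>s\<close> has a 2 in column \<open>v\<close>, since
      \<open>\<phi>\<close> is injective. The product of rows \<open>t\<close> and \<open>x\<close>
      is \<open>2 * w x u + w x v\<close>, so parity excludes a 1.\<close>
    have "w x v = 0" if x: "x \<in> N" "x \<noteq> s" "x \<noteq> t" for x
    proof -
      have "w x v \<noteq> 2"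
      proof
        assume "w x v = 2"
        then have "x \<in> D" "\<phi> x = v" using x v \<phi>_unique by (auto simp: D_def)
        then show False using inj s x(2) by (auto dest: inj_onD)
      qed
      moreover have "w x v \<noteq> 3" using two x by blast
      moreover have "w x v \<noteq> 1"
        using ev[OF t(1) x(1)] x(3) sum_shape2[OF t(1,3,2,4) v, of "w x"] by auto
      moreover have "w x v \<le> 3" using le3 x v by blast
      ultimately show ?thesis by linarith
    qed
    then have "(\<Sum>x\<in>N. w x v) = (\<Sum>x\<in>{s,t}. w x v)"
      using fin two(1) t(1) by (intro sum.mono_neutral_right) auto
    also have "\<dots> \<le> 3" using two(2) t(4) by (cases "s = t") auto
    finally show ?thesis .
  next
    case one
    define T where "T = {q \<in> N. \<forall>a\<in>N. w q a \<le> 1}"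
    define X where "X q = {a \<in> N. w q a = 1}" for q
    have wX: "w q a = of_bool (a \<in> X q)" if "q \<in> T" "a \<in> N" for q a
    proof -
      have "w q a \<le> 1" using that by (auto simp: T_def)
      then show ?thesis using that by (auto simp: X_def)
    qed
    \<comment> \<open>A row with a 1 at \<open>v\<close> cannot contain a 3, and a 2 at
      \<open>a\<close> would by \<open>double\<close> give \<open>w a v = 2\<close>, against the
      case assumption.\<close>
    have T: "q \<in> T" if q: "q \<in> N" "w q v = 1" for q
    proof -
      have "w q a \<le> 1" if a: "a \<in> N" for a
      proof (rule ccontr)
        assume "\<not> ?thesis"
        then consider "w q a = 3" | "w q a = 2" using le3[OF q(1) a] by linarith
        then show False
        proof cases
          case 1
          then show False using shape3[OF q(1) 1 a v] q(2) by (cases "v = a") auto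
        next
          case 2
          then show False using double[OF q(1) a v 2 q(2)] one a by force
        qed
      qed
      then show ?thesis using q by (auto simp: T_def)
    qed
    \<comment> \<open>If row \<open>a\<close> had a 3, its product with row \<open>q\<close> would
      be 3. If it had a 2, the row \<open>t\<close> from \<open>pre2\<close> would have product
      \<open>2 * w q u + 1\<close> with row \<open>q\<close>. Both are odd.\<close>
    have X_T: "X q \<subseteq> T" if q: "q \<in> T" for q
    proof
      fix a assume "a \<in> X q"
      then have a: "a \<in> N" "w q a = 1" by (auto simp: X_def)
      have qN: "q \<in> N" using q by (auto simp: T_def)
      have "w a b \<le> 1" if b: "b \<in> N" for b
      proof (rule ccontr)
        assume "\<not> ?thesis"
        then consider "w a b = 3" | "w a b = 2" using le3[OF a(1) b] by linarith
        then show False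
        proof cases
          case 1
          have "q \<noteq> a" using 1 q b by (auto simp: T_def)
          then show False using ev[OF a(1) qN] sum_shape3[OF a(1) 1 b, of "w q"] a(2) by auto
        next
          case 2
          then have "a \<in> D" using a b by (auto simp: D_def)
          then obtain t u where t: "t \<in> N" "u \<in> N" "w t u = 2" "w t a = 1" using pre2 by blast
          have "t \<noteq> q" using t q by (auto simp: T_def)
          then show False using ev[OF t(1) qN] sum_shape2[OF t(1,3,2,4) a(1), of "w q"] a(2) by auto
        qed
      qed
      then show "a \<in> T" using a by (auto simp: T_def)
    qed
    have XN: "X q \<subseteq> N" for q by (auto simp: X_def)
    have sum_X: "(\<Sum>a\<in>N. w q a * f a) = sum f (X q)" if "q \<in> T" for q f
    proof -
      have "(\<Sum>a\<in>N. w q a * f a) = (\<Sum>a\<in>X q. w q a * f a)"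
        using fin XN wX[OF that] by (intro sum.mono_neutral_right) auto
      also have "\<dots> = sum f (X q)" by (intro sum.cong) (auto simp: X_def)
      finally show ?thesis .
    qed
    have card_X: "card (X q) = 3" if "q \<in> T" for q
      using sum_X[OF that, of "\<lambda>_. 1"] sum3[of q] that by (simp add: T_def)
    have even_X: "even (card (X q \<inter> X q'))" if q: "q \<in> T" "q' \<in> T" "q \<noteq> q'" for q q'
    proof -
      have "(\<Sum>a\<in>N. w q a * w q' a) = (\<Sum>a\<in>X q. of_bool (a \<in> X q'))"
        using sum_X[OF q(1)] wX[OF q(2)] XN by (simp add: subset_iff)
      also have "\<dots> = card (X q \<inter> X q')"
        using finite_subset[OF XN fin, of q] by (simp add: Int_def)
      finally show ?thesis using ev q by (metis (no_types, lifting) T_def mem_Collect_eq)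
    qed
    have finT: "finite T" using fin by (simp add: T_def)
    have "(\<Sum>s\<in>N. w s v) = (\<Sum>s\<in>{q \<in> T. v \<in> X q}. w s v)"
    proof (rule sum.mono_neutral_right[OF fin])
      show "\<forall>i\<in>N - {q \<in> T. v \<in> X q}. w i v = 0"
      proof
        fix i assume i: "i \<in> N - {q \<in> T. v \<in> X q}"
        then have "w i v \<noteq> 1" using T v by (auto simp: X_def)
        moreover have "w i v \<le> 1" using one i by blast
        ultimately show "w i v = 0" by linarith
      qed
    qed (auto simp: T_def)
    also have "\<dots> = card {q \<in> T. v \<in> X q}" by (simp add: X_def)
    finally have eq: "(\<Sum>s\<in>N. w s v) = card {q \<in> T. v \<in> X q}" .
    show ?thesis
    proof (cases "{q \<in> T. v \<in> X q} = {}")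
      case False
      then have "v \<in> T" using X_T by blast
      from triples_even_intersections[where X = X, OF finT X_T card_X even_X this]
      show ?thesis using eq by simp
    next
      case True
      then show ?thesis by (simp only: eq card.empty)
    qed
  qed
qed

section \<open>Equivalenced schemes and neighbourhoods\<close>

locale equivalenced_scheme = association_scheme +
  fixes k :: nat
  assumes equivalenced: "equivalenced k \<Omega> S"
    and k_pos: "0 < k"
begin

definition N :: "('a \<times> 'a) set set" where
  "N = S - {Id_on \<Omega>}"

abbreviation r :: "'a \<Rightarrow> 'a \<Rightarrow> ('a \<times> 'a) set" where
  "r \<equiv> class_of S"

abbreviation c where "c \<equiv> intersection_number \<Omega>"

definition nb :: "'a \<Rightarrow> ('a \<times> 'a) set \<Rightarrow> 'a set" where
  "nb x s = {y \<in> \<Omega>. (x, y) \<in> s}"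

definition w :: "('a \<times> 'a) set \<Rightarrow> ('a \<times> 'a) set \<Rightarrow> nat" where
  "w s v = c s (s\<inverse>) v"

lemma finite_S: "finite S"
proof -
  have "S \<subseteq> Pow (\<Omega> \<times> \<Omega>)" using partition by (auto simp: partition_on_def)
  then show ?thesis using finite_points finite_subset by blast
qed

lemma finite_N: "finite N"
  using finite_S by (simp add: N_def)

lemma N_S: "s \<in> N \<Longrightarrow> s \<in> S"
  by (simp add: N_def)

lemma converse_N: "s \<in> N \<Longrightarrow> s\<inverse> \<in> N"
  using transpose by (auto simp: N_def) (metis converse_Id_on converse_converse)

lemma class_points: "s \<in> S \<Longrightarrow> (x, y) \<in> s \<Longrightarrow> x \<in> \<Omega> \<and> y \<in> \<Omega>"
  using partition by (auto simp: partition_on_def)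

lemma class_nonempty: "s \<in> S \<Longrightarrow> \<exists>x y. (x, y) \<in> s"
  using partition by (metis partition_onD3 ex_in_conv surj_pair)

lemma mem_class_iff:
  assumes "x \<in> \<Omega>" "y \<in> \<Omega>" "s \<in> S"
  shows "(x, y) \<in> s \<longleftrightarrow> r x y = s"
proof -
  have "\<exists>!s. s \<in> S \<and> (x, y) \<in> s"
    using partition assms(1,2) by (auto simp: partition_on_def disjoint_def)
  then show ?thesis using assms(3) unfolding class_of_def by (metis (mono_tags, lifting) theI')
qed

lemma r_S:
  assumes "x \<in> \<Omega>" "y \<in> \<Omega>"
  shows "r x y \<in> S"
proof -
  obtain s where "s \<in> S" "(x, y) \<in> s"
    using partition assms by (auto simp: partition_on_def)
  then show ?thesis using mem_class_iff assms by metis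
qed

lemma r_eq_Id_iff:
  assumes "x \<in> \<Omega>" "y \<in> \<Omega>"
  shows "r x y = Id_on \<Omega> \<longleftrightarrow> x = y"
  using mem_class_iff[OF assms diagonal] assms by auto

lemma r_N: "x \<in> \<Omega> \<Longrightarrow> y \<in> \<Omega> \<Longrightarrow> x \<noteq> y \<Longrightarrow> r x y \<in> N"
  using r_S r_eq_Id_iff by (simp add: N_def)

lemma N_irrefl: "s \<in> N \<Longrightarrow> (x, y) \<in> s \<Longrightarrow> x \<noteq> y"
  using class_points mem_class_iff r_eq_Id_iff by (metis DiffE N_def singletonI)

lemma r_converse:
  assumes "x \<in> \<Omega>" "y \<in> \<Omega>"
  shows "r y x = (r x y)\<inverse>"
  using mem_class_iff[OF assms(2,1) transpose[OF r_S[OF assms]]] mem_class_iff[OF assms r_S[OF assms]]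
  by simp

lemma nb_subset: "nb x s \<subseteq> \<Omega>"
  by (auto simp: nb_def)

lemma finite_nb: "finite (nb x s)"
  using nb_subset finite_points finite_subset by blast

lemma mem_nb_iff: "s \<in> S \<Longrightarrow> y \<in> nb x s \<longleftrightarrow> (x, y) \<in> s"
  using class_points by (auto simp: nb_def)

lemma mem_nb_r_iff: "x \<in> \<Omega> \<Longrightarrow> s \<in> S \<Longrightarrow> y \<in> nb x s \<longleftrightarrow> y \<in> \<Omega> \<and> r x y = s"
  using mem_class_iff by (auto simp: nb_def)

text \<open>Regularity makes the \<open>THE\<close> in \<open>intersection_number\<close> well
  defined, so paths can be counted at any chosen pair. The points from which \<open>t\<close> leads
  to \<open>y\<close> form a neighbourhood of \<open>y\<close> in the transposed class.\<close>

lemma card_paths: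
  assumes "s \<in> S" "t \<in> S" "v \<in> S" "(x, y) \<in> v"
  shows "card (nb x s \<inter> nb y (t\<inverse>)) = c s t v"
proof -
  obtain n where n: "\<forall>(x, y)\<in>v. triangles \<Omega> s t x y = n" using regular assms by blast
  have "c s t v = n"
    unfolding intersection_number_def
  proof (rule the_equality)
    show "m = n" if "\<forall>(x, y)\<in>v. triangles \<Omega> s t x y = m" for m
      using that n assms(4) by auto
  qed (rule n)
  moreover have "nb x s \<inter> nb y (t\<inverse>) = {z \<in> \<Omega>. (x, z) \<in> s \<and> (z, y) \<in> t}"
    by (auto simp: nb_def)
  ultimately show ?thesis using n assms(4) by (auto simp: triangles_def)
qed

lemma card_nb:
  assumes "s \<in> N" "x \<in> \<Omega>"
  shows "card (nb x s) = k"
proof -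
  \<comment> \<open>The valency counts paths leaving \<open>x\<close> along \<open>s\<close> and
    returning along \<open>s\<inverse>\<close>; both ends give the same neighbourhood.\<close>
  have "card (nb x s \<inter> nb x ((s\<inverse>)\<inverse>)) = c s (s\<inverse>) (Id_on \<Omega>)"
    using assms by (intro card_paths transpose diagonal N_S) auto
  then show ?thesis
    using assms equivalenced by (simp add: equivalenced_def valency_def N_def)
qed

lemma w_eq:
  assumes "s \<in> N" "v \<in> N" "(x, y) \<in> v"
  shows "w s v = card (nb x s \<inter> nb y s)"
  using card_paths[of s "s\<inverse>" v x y] assms by (simp add: w_def N_S transpose)

section \<open>Symmetries of intersection numbers, row sums and row products of the weights\<close>

lemma c_converse:
  assumes "s \<in> S" "t \<in> S" "v \<in> S"
  shows "c s t v = c (t\<inverse>) (s\<inverse>) (v\<inverse>)"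
proof -
  obtain x y where xy: "(x, y) \<in> v" using class_nonempty assms by blast
  show ?thesis
    using card_paths[OF assms xy] card_paths[of "t\<inverse>" "s\<inverse>" "v\<inverse>" y x] xy assms
    by (simp add: transpose Int_commute)
qed

text \<open>Both sides count the pairs \<open>(z, y)\<close> with \<open>(x, z) \<in> s\<close>, \<open>(z, y) \<in> t\<close>, \<open>(x, y) \<in> v\<close>
  for a fixed \<open>x\<close>; equal valencies then cancel.\<close>

lemma c_swap:
  assumes "s \<in> N" "t \<in> S" "v \<in> N"
  shows "c s t v = c v (t\<inverse>) s"
proof -
  obtain x where x: "x \<in> \<Omega>" using class_nonempty[OF diagonal] by auto
  have "card {z \<in> nb x s. (z, y) \<in> t} = c s t v" if "y \<in> nb x v" for y
  proof -
    have "{z \<in> nb x s. (z, y) \<in> t} = nb x s \<inter> nb y (t\<inverse>)" by (auto simp: nb_def)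
    then show ?thesis using card_paths[of s t v x y] that assms by (simp add: N_S nb_def)
  qed
  moreover have "card {y \<in> nb x v. (z, y) \<in> t} = c v (t\<inverse>) s" if "z \<in> nb x s" for z
  proof -
    have "{y \<in> nb x v. (z, y) \<in> t} = nb x v \<inter> nb z ((t\<inverse>)\<inverse>)" by (auto simp: nb_def)
    then show ?thesis using card_paths[of v "t\<inverse>" s x z] that assms
      by (simp add: N_S nb_def transpose)
  qed
  ultimately have "card (nb x v) * c s t v = card (nb x s) * c v (t\<inverse>) s"
    using sum_card_swap[OF finite_nb finite_nb, where R = "\<lambda>y z. (z, y) \<in> t", of x s x v] by simp
  then show ?thesis using card_nb assms x k_pos by simp
qed

text \<open>An application of \<open>c_swap\<close> between two path reversals. It identifies
  \<open>c q t s\<close> with the coefficient of \<open>t\<close> in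
  \<open>q\<^sup>* s\<close>.\<close>

lemma c_rotate:
  assumes "q \<in> S" "t \<in> N" "s \<in> N"
  shows "c q t s = c (q\<inverse>) s t"
proof -
  have "c q t s = c (t\<inverse>) (q\<inverse>) (s\<inverse>)" 
    by (rule c_converse[OF assms(1) N_S[OF assms(2)] N_S[OF assms(3)]])
  also have "\<dots> = c (s\<inverse>) ((q\<inverse>)\<inverse>) (t\<inverse>)"
    by (rule c_swap[OF converse_N[OF assms(2)] transpose[OF assms(1)] converse_N[OF assms(3)]])
  also have "\<dots> = c (q\<inverse>) s t"
    using c_converse[of "q\<inverse>" s t] assms by (simp add: N_S transpose)
  finally show ?thesis .
qed

text \<open>By \<open>c_swap\<close>, \<open>w s v\<close> equals \<open>c v s s\<close>. Thus row
  \<open>s\<close> records how often each relation occurs from \<open>x\<close> to the points of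
  \<open>nb y (s\<inverse>)\<close>.\<close>

lemma w_in_nb:
  assumes "s \<in> N" "v \<in> N" "(x, y) \<in> s"
  shows "w s v = card {x' \<in> nb y (s\<inverse>). r x x' = v}"
proof -
  have xy: "x \<in> \<Omega>" "y \<in> \<Omega>" using class_points assms N_S by blast+
  have "w s v = c v s s"
    using c_swap[OF assms(1) transpose assms(2), of s] assms by (simp add: w_def N_S)
  also have "\<dots> = card (nb x v \<inter> nb y (s\<inverse>))"
    using card_paths assms N_S by metis
  also have "nb x v \<inter> nb y (s\<inverse>) = {x' \<in> nb y (s\<inverse>). r x x' = v}"
    using mem_class_iff[OF xy(1) _ N_S[OF assms(2)]] by (auto simp: nb_def)
  finally show ?thesis .
qed

lemma sum_in_nb:
  fixes f :: "('a \<times> 'a) set \<Rightarrow> nat"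
  assumes "s \<in> N" "(x, y) \<in> s"
  shows "(\<Sum>x'\<in>nb y (s\<inverse>) - {x}. f (r x x')) = (\<Sum>v\<in>N. w s v * f v)"
proof -
  have xy: "x \<in> \<Omega>" "y \<in> \<Omega>" using class_points assms N_S by blast+
  have "(\<Sum>x'\<in>nb y (s\<inverse>) - {x}. f (r x x'))
      = (\<Sum>v\<in>N. card {x' \<in> nb y (s\<inverse>) - {x}. r x x' = v} * f v)"
    using finite_nb finite_N nb_subset xy r_N by (intro sum_group_card) fastforce+
  also have "\<dots> = (\<Sum>v\<in>N. w s v * f v)"
  proof (rule sum.cong)
    fix v assume v: "v \<in> N"
    have "{x' \<in> nb y (s\<inverse>) - {x}. r x x' = v} = {x' \<in> nb y (s\<inverse>). r x x' = v}"
      using v r_eq_Id_iff[OF xy(1) xy(1)] by (auto simp: N_def)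
    then show "card {x' \<in> nb y (s\<inverse>) - {x}. r x x' = v} * f v = w s v * f v"
      using w_in_nb[OF assms(1) v assms(2)] by simp
  qed simp
  finally show ?thesis .
qed

lemma sum_w:
  assumes "s \<in> N"
  shows "(\<Sum>v\<in>N. w s v) = k - 1"
proof -
  obtain x y where xy: "(x, y) \<in> s" using class_nonempty assms N_S by blast
  have y: "x \<in> \<Omega>" "y \<in> \<Omega>" using class_points xy assms N_S by blast+
  have "x \<in> nb y (s\<inverse>)" using xy y by (simp add: nb_def)
  then have "card (nb y (s\<inverse>) - {x}) = k - 1"
    using card_nb[OF converse_N[OF assms] y(2)] by simp
  then show ?thesis using sum_in_nb[OF assms xy, of "\<lambda>_. 1"] by simp
qed

text \<open>As \<open>q \<noteq> s\<close>, no \<open>q\<close>-neighbour of \<open>x\<close> equals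
  \<open>y\<close>; the diagonal class never occurs, and summing over \<open>N\<close> loses
  nothing.\<close>

lemma sum_c:
  assumes "q \<in> N" "s \<in> N" "q \<noteq> s" and xy: "(x, y) \<in> s"
  shows "(\<Sum>z\<in>nb x q. f (r z y)) = (\<Sum>u\<in>N. c q u s * (f u :: nat))"
proof -
  have pts: "x \<in> \<Omega>" "y \<in> \<Omega>" using class_points xy assms N_S by blast+
  have "r x y = s" using mem_class_iff pts xy assms N_S by blast
  then have ne: "z \<noteq> y" if "z \<in> nb x q" for z
    using that mem_nb_r_iff[OF pts(1) N_S[OF assms(1)]] assms(3) by auto
  have "(\<Sum>z\<in>nb x q. f (r z y)) = (\<Sum>u\<in>N. card {z \<in> nb x q. r z y = u} * f u)"
    using finite_nb finite_N nb_subset pts r_N ne by (intro sum_group_card) fastforce+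
  also have "\<dots> = (\<Sum>u\<in>N. c q u s * f u)"
  proof (rule sum.cong)
    fix u assume u: "u \<in> N"
    have "{z \<in> nb x q. r z y = u} = nb x q \<inter> nb y (u\<inverse>)"
      using mem_class_iff[OF _ pts(2) N_S[OF u]] by (auto simp: nb_def)
    then show "card {z \<in> nb x q. r z y = u} * f u = c q u s * f u"
      using card_paths[OF N_S N_S N_S xy] assms u by simp
  qed simp
  finally show ?thesis .
qed

text \<open>The entries of the product \<open>q\<^sup>* s\<close> have square norm \<open>\<langle>q q\<^sup>*, s s\<^sup>*\<rangle>\<close>; the diagonal part
  of the latter contributes \<open>k\<close>.\<close>

lemma sum_c_square:
  assumes q: "q \<in> N" and s: "s \<in> N" and ne: "q \<noteq> s"
  shows "(\<Sum>u\<in>N. c q u s * c q u s) = k + (\<Sum>v\<in>N. w q v * w s v)"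
proof -
  obtain y where y: "y \<in> \<Omega>" using class_nonempty[OF diagonal] by auto
  \<comment> \<open>Triples \<open>(x, x', z)\<close> with \<open>x\<close>, \<open>x'\<close> in
    \<open>I\<close> and both \<open>s\<close>-related to \<open>z\<close> are counted in two ways:
    by the relation from \<open>y\<close> to \<open>z\<close>, giving the squares, and by the
    relation from \<open>x\<close> to \<open>x'\<close>, giving \<open>k\<close> on the diagonal and
    products of weights off it. Both counts carry a further factor \<open>k\<close>.\<close>
  define I where "I = nb y (q\<inverse>)"
  have I: "finite I" "I \<subseteq> \<Omega>" "card I = k"
    using finite_nb nb_subset card_nb[OF converse_N[OF q] y] by (auto simp: I_def)
  have xI: "(x, y) \<in> q \<longleftrightarrow> x \<in> I" for x
    using class_points[OF N_S[OF q]] by (auto simp: I_def nb_def)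
  have m: "card {x \<in> I. (x, z) \<in> s} = c q u s" if "u \<in> N" "(y, z) \<in> u" for u z
  proof -
    have "{x \<in> I. (x, z) \<in> s} = nb y (q\<inverse>) \<inter> nb z (s\<inverse>)" by (auto simp: I_def nb_def)
    then show ?thesis
      using card_paths[of "q\<inverse>" s u y z] c_rotate[of q u s] q s that by (simp add: N_S transpose)
  qed
  \<comment> \<open>The term for \<open>z = y\<close> vanishes because
    \<open>q \<noteq> s\<close>.\<close>
  have "y \<notin> nb x s" if "x \<in> I" for x
    using that xI mem_class_iff[OF _ y N_S[OF q]] mem_class_iff[OF _ y N_S[OF s]] ne I(2)
    by (auto simp: nb_def)
  then have m0: "{x \<in> I. (x, y) \<in> s} = {}" using y by (auto simp: nb_def)
  have "(\<Sum>z\<in>\<Omega>. card {x \<in> I. (x, z) \<in> s} ^ 2)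
      = (\<Sum>z\<in>\<Omega> - {y}. card {x \<in> I. (x, z) \<in> s} ^ 2)"
    using sum.remove[OF finite_points y, of "\<lambda>z. card {x \<in> I. (x, z) \<in> s} ^ 2"] m0 by simp
  also have "\<dots> = (\<Sum>z\<in>\<Omega> - {y}. c q (r y z) s ^ 2)"
    using m y r_N mem_class_iff r_S by (intro sum.cong refl) (metis DiffE insertI1)
  also have "\<dots> = (\<Sum>u\<in>N. card {z \<in> \<Omega> - {y}. r y z = u} * c q u s ^ 2)"
    using finite_points finite_N r_N y by (intro sum_group_card) auto
  also have "\<dots> = (\<Sum>u\<in>N. k * c q u s ^ 2)"
  proof (rule sum.cong)
    fix u assume u: "u \<in> N"
    have "{z \<in> \<Omega> - {y}. r y z = u} = nb y u"
      using mem_nb_r_iff[OF y N_S[OF u]] r_eq_Id_iff[OF y y] u by (auto simp: N_def)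
    then show "card {z \<in> \<Omega> - {y}. r y z = u} * c q u s ^ 2 = k * c q u s ^ 2"
      using card_nb[OF u y] by simp
  qed simp
  finally have lhs: "(\<Sum>z\<in>\<Omega>. card {x \<in> I. (x, z) \<in> s} ^ 2) = k * (\<Sum>u\<in>N. c q u s * c q u s)"
    by (simp add: sum_distrib_left power2_eq_square)
  have "card {x \<in> I. (x, z) \<in> s} ^ 2 = card {p \<in> I \<times> I. (fst p, z) \<in> s \<and> (snd p, z) \<in> s}" for z
  proof -
    have "{p \<in> I \<times> I. (fst p, z) \<in> s \<and> (snd p, z) \<in> s} = {x \<in> I. (x, z) \<in> s} \<times> {x \<in> I. (x, z) \<in> s}"
      by auto
    then show ?thesis by (simp only: card_cartesian_product power2_eq_square)
  qed
  then have "(\<Sum>z\<in>\<Omega>. card {x \<in> I. (x, z) \<in> s} ^ 2)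
      = (\<Sum>z\<in>\<Omega>. card {p \<in> I \<times> I. (fst p, z) \<in> s \<and> (snd p, z) \<in> s})"
    by simp
  also have "\<dots> = (\<Sum>p\<in>I \<times> I. card {z \<in> \<Omega>. (fst p, z) \<in> s \<and> (snd p, z) \<in> s})"
    using I(1) finite_points by (intro sum_card_swap) auto
  also have "\<dots> = (\<Sum>p\<in>I \<times> I. card (nb (fst p) s \<inter> nb (snd p) s))"
    by (intro sum.cong arg_cong[where f = card]) (auto simp: nb_def)
  also have "\<dots> = (\<Sum>x\<in>I. \<Sum>x'\<in>I. card (nb x s \<inter> nb x' s))"
    by (simp add: sum.cartesian_product case_prod_beta)
  also have "\<dots> = (\<Sum>x\<in>I. k + (\<Sum>v\<in>N. w q v * w s v))"
  proof (rule sum.cong)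
    fix x assume x: "x \<in> I"
    have "(\<Sum>x'\<in>I. card (nb x s \<inter> nb x' s)) = k + (\<Sum>x'\<in>I - {x}. card (nb x s \<inter> nb x' s))"
      using sum.remove[OF I(1) x, of "\<lambda>x'. card (nb x s \<inter> nb x' s)"] card_nb[OF s, of x] x I(2)
      by (simp add: subset_iff)
    also have "(\<Sum>x'\<in>I - {x}. card (nb x s \<inter> nb x' s)) = (\<Sum>x'\<in>I - {x}. w s (r x x'))"
    proof (rule sum.cong)
      fix x' assume "x' \<in> I - {x}"
      then have "x \<in> \<Omega>" "x' \<in> \<Omega>" "x \<noteq> x'" using x I(2) by auto
      then show "card (nb x s \<inter> nb x' s) = w s (r x x')"
        using w_eq[OF s r_N, of x x' x x'] mem_class_iff[OF _ _ r_S, of x x' x x'] by simp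
    qed simp
    also have "\<dots> = (\<Sum>v\<in>N. w q v * w s v)"
      unfolding I_def using sum_in_nb[OF q] x xI by blast
    finally show "(\<Sum>x'\<in>I. card (nb x s \<inter> nb x' s)) = k + (\<Sum>v\<in>N. w q v * w s v)" .
  qed simp
  finally have "(\<Sum>z\<in>\<Omega>. card {x \<in> I. (x, z) \<in> s} ^ 2) = k * (k + (\<Sum>v\<in>N. w q v * w s v))"
    using I(3) by simp
  then show ?thesis using lhs k_pos by simp
qed

text \<open>Since \<open>n\<^sup>2 \<equiv> n (mod 2)\<close>, the sum of squares has the parity of \<open>\<Sum>u. c q u s = k\<close>.\<close>

lemma even_sum_w_mult:
  assumes "q \<in> N" "s \<in> N" "q \<noteq> s"
  shows "even (\<Sum>v\<in>N. w q v * w s v)"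
proof -
  obtain x y where xy: "(x, y) \<in> s" using class_nonempty assms N_S by blast
  have "x \<in> \<Omega>" using class_points xy assms N_S by blast
  then have "k = (\<Sum>u\<in>N. c q u s)"
    using sum_c[OF assms xy, of "\<lambda>_. 1"] card_nb assms by simp
  moreover have "even ((\<Sum>u\<in>N. c q u s * c q u s) + (\<Sum>u\<in>N. c q u s))"
    unfolding sum.distrib[symmetric] by (intro dvd_sum) simp
  ultimately have "even (k + (\<Sum>v\<in>N. w q v * w s v) + k)"
    using sum_c_square[OF assms] by simp
  then show ?thesis by (simp add: even_add) argo
qed

lemma w_converse:
  assumes "s \<in> N" "v \<in> N"
  shows "w s (v\<inverse>) = w s v"
proof -
  obtain x y where xy: "(x, y) \<in> v" using class_nonempty assms N_S by blast
  then show ?thesis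
    using w_eq[OF assms xy] w_eq[OF assms(1) converse_N[OF assms(2)], of y x] by (simp add: Int_commute)
qed

section \<open>Fixed points of an automorphism\<close>

lemma card_fixed_points_le:
  assumes \<tau>: "\<tau> \<in> Aut \<Omega> S" and z: "\<tau> z \<noteq> z"
  shows "card {x \<in> \<Omega>. \<tau> x = x} \<le> (\<Sum>q\<in>N. w q (r z (\<tau> z)))"
proof -
  have perm: "\<tau> permutes \<Omega>" and aut: "\<And>x y. \<lbrakk>x \<in> \<Omega>; y \<in> \<Omega>\<rbrakk> \<Longrightarrow> r (\<tau> x) (\<tau> y) = r x y"
    using \<tau> by (auto simp: Aut_def)
  have z\<Omega>: "z \<in> \<Omega>" "\<tau> z \<in> \<Omega>" using perm z permutes_not_in permutes_in_image by metis+
  have "{x \<in> \<Omega>. \<tau> x = x} \<subseteq> (\<Union>q\<in>N. nb z q \<inter> nb (\<tau> z) q)"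
  proof
    fix x assume "x \<in> {x \<in> \<Omega>. \<tau> x = x}"
    then have x: "x \<in> \<Omega>" "\<tau> x = x" by auto
    have "r z x \<in> N" using r_N z\<Omega> x z by metis
    moreover have "r (\<tau> z) x = r z x" using aut[OF z\<Omega>(1) x(1)] x(2) by simp
    ultimately have "x \<in> nb z (r z x) \<inter> nb (\<tau> z) (r z x)"
      using mem_nb_r_iff z\<Omega> x N_S by blast
    then show "x \<in> (\<Union>q\<in>N. nb z q \<inter> nb (\<tau> z) q)" using \<open>r z x \<in> N\<close> by blast
  qed
  then have "card {x \<in> \<Omega>. \<tau> x = x} \<le> card (\<Union>q\<in>N. nb z q \<inter> nb (\<tau> z) q)"
    using finite_N finite_nb by (intro card_mono) auto
  also have "\<dots> \<le> (\<Sum>q\<in>N. card (nb z q \<inter> nb (\<tau> z) q))"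
    using finite_N by (rule card_UN_le)
  also have "\<dots> = (\<Sum>q\<in>N. w q (r z (\<tau> z)))"
    using r_N r_S z\<Omega> z mem_class_iff by (intro sum.cong refl w_eq[symmetric]) metis+
  finally show ?thesis .
qed

end

section \<open>Local structure of schemes of valency 4\<close>

locale four_equivalenced_scheme = equivalenced_scheme \<Omega> S 4
  for \<Omega> :: "'a set" and S
begin

lemma w_le:
  assumes "s \<in> N" "u \<in> N" "v \<in> N" "u \<noteq> v"
  shows "w s u + w s v \<le> 3"
proof -
  have "sum (w s) {u, v} \<le> sum (w s) N" using assms finite_N by (intro sum_mono2) auto
  then show ?thesis using sum_w[OF assms(1)] assms by simp
qed

text \<open>Here \<open>s s\<^sup>* = 4 + 3u\<close>. Two \<open>u\<close>-neighbours of \<open>x\<close> share with \<open>x\<close> three of the four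
  \<open>s\<close>-neighbours of \<open>x\<close> each, hence have one in common and are themselves \<open>u\<close>-related: \<open>u\<close> is a
  disjoint union of complete graphs \<open>K\<^sub>5\<close>, and parity leaves only \<open>u = s\<close>.\<close>

lemma w_eq_3:
  assumes s: "s \<in> N" and u: "u \<in> N" and 3: "w s u = 3"
  shows "u = s"
proof (rule ccontr)
  assume ne: "u \<noteq> s"
  have only: "w s v = 0" if "v \<in> N" "v \<noteq> u" for v
    using w_le[OF s u that(1)] that(2) 3 by simp
  obtain x x' where xx': "(x, x') \<in> u" using class_nonempty u N_S by blast
  have pts: "x \<in> \<Omega>" "x' \<in> \<Omega>" using class_points xx' u N_S by blast+
  have "nb x u - {x'} \<subseteq> nb x u \<inter> nb x' u"
  proof
    fix x'' assume x'': "x'' \<in> nb x u - {x'}"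
    then have pt: "x'' \<in> \<Omega>" "(x, x'') \<in> u" "x' \<noteq> x''" by (auto simp: nb_def)
    let ?A = "nb x s \<inter> nb x' s" and ?B = "nb x s \<inter> nb x'' s"
    have "card ?A = 3" "card ?B = 3" using w_eq[OF s u] xx' pt 3 by simp_all
    moreover have "card (?A \<union> ?B) \<le> 4"
      using card_mono[OF finite_nb, of "?A \<union> ?B" x s] card_nb[OF s pts(1)] by auto
    ultimately have "card (?A \<inter> ?B) \<ge> 2"
      using card_Un_Int[of ?A ?B] finite_nb by auto
    then have "?A \<inter> ?B \<noteq> {}" by (metis card.empty not_numeral_le_zero)
    then have "nb x' s \<inter> nb x'' s \<noteq> {}" by blast
    moreover have "r x' x'' \<in> N" using r_N pts pt by blast
    moreover have "(x', x'') \<in> r x' x''" using mem_class_iff r_S pts pt by blast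
    ultimately have "w s (r x' x'') \<noteq> 0" using w_eq[OF s] finite_nb by simp
    then have "r x' x'' = u" using only[OF \<open>r x' x'' \<in> N\<close>] by argo
    then show "x'' \<in> nb x u \<inter> nb x' u" using x'' mem_nb_r_iff[OF pts(2) N_S[OF u]] pt(1) by simp
  qed
  then have "card (nb x u - {x'}) \<le> w u u"
    using w_eq[OF u u xx'] finite_nb by (metis card_mono finite_Int)
  moreover have "card (nb x u - {x'}) = 3"
    using card_nb[OF u pts(1)] xx' pts by (simp add: nb_def)
  moreover have "w u u \<le> 3" using w_le[OF u u s ne] by simp
  ultimately have uu: "w u u = 3" by simp
  \<comment> \<open>Row \<open>s\<close> has its only nonzero entry at \<open>u\<close>, so the
    product is 3 * 3 = 9, which is odd.\<close>
  have "(\<Sum>v\<in>N. w s v * w u v) = (\<Sum>v\<in>{u}. w s v * w u v)"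
    using finite_N u only by (intro sum.mono_neutral_right) auto
  then show False using even_sum_w_mult[OF s u] ne 3 uu by simp
qed

text \<open>The four \<open>s\<^sup>*\<close>-neighbours of a point form a \<open>u\<close>-coloured 4-cycle with \<open>v\<close>-coloured
  diagonals.\<close>

lemma w_eq_2:
  assumes s: "s \<in> N" and u: "u \<in> N" and v: "v \<in> N" and 2: "w s u = 2" and 1: "w s v = 1"
  shows "w u v = 2"
proof -
  obtain a b where ab: "(a, b) \<in> v" using class_nonempty v N_S by blast
  have pts: "a \<in> \<Omega>" "b \<in> \<Omega>" "a \<noteq> b" using class_points ab v N_S N_irrefl by blast+
  have "card (nb a s \<inter> nb b s) = 1" using w_eq[OF s v ab] 1 by simp
  then obtain y where "y \<in> nb a s \<inter> nb b s" by (metis card_1_singletonE insertI1)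
  then have y: "y \<in> \<Omega>" "(a, y) \<in> s" "(b, y) \<in> s" by (auto simp: nb_def)
  let ?I = "nb y (s\<inverse>)"
  have I: "card (?I - {a, b}) = 2"
    using card_nb[OF converse_N[OF s] y(1)] y pts by (simp add: nb_def card_Diff_subset)
  have rab: "r a b = v" "r b a = v\<inverse>" using mem_class_iff ab v N_S pts r_converse by metis+
  \<comment> \<open>The relation from \<open>b\<close> to \<open>a\<close> is
    \<open>v\<inverse>\<close>, which also has weight 1; hence neither direction of the diagonal is
    \<open>u\<close>.\<close>
  have uv: "u \<noteq> v" "u \<noteq> v\<inverse>" using 1 2 w_converse[OF s v] by auto
  have r_refl: "r a a \<noteq> u" "r b b \<noteq> u" using r_eq_Id_iff pts u by (auto simp: N_def)
  \<comment> \<open>Each of \<open>a\<close> and \<open>b\<close> is \<open>u\<close>-related to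
    \<open>w s u = 2\<close> points of \<open>?I\<close>, and exactly two points remain besides
    \<open>a\<close> and \<open>b\<close>.\<close>
  have "{x \<in> ?I. r a x = u} = ?I - {a, b}" "{x \<in> ?I. r b x = u} = ?I - {a, b}"
    using w_in_nb[OF s u y(2)] w_in_nb[OF s u y(3)] 2 I rab uv r_refl finite_nb
    by (intro card_subset_eq; force)+
  then have "?I - {a, b} \<subseteq> nb a u \<inter> nb b u"
    using mem_nb_r_iff[OF pts(1) N_S[OF u]] mem_nb_r_iff[OF pts(2) N_S[OF u]] nb_subset[of y "s\<inverse>"]
    by fast
  then have "2 \<le> w u v"
    using w_eq[OF u v ab] I finite_nb by (metis card_mono finite_Int)
  moreover have "w u v \<le> 3" using w_le[OF u v u] uv by simp
  moreover have "w u v \<noteq> 3" using w_eq_3[OF u v] uv by blast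
  ultimately show ?thesis by simp
qed

lemma sum_w_column_le:
  assumes "v \<in> N"
  shows "(\<Sum>q\<in>N. w q v) \<le> 3"
proof (rule weights_column_sum_le[OF finite_N _ even_sum_w_mult w_eq_3 w_eq_2 assms])
  show "(\<Sum>v\<in>N. w s v) = 3" if "s \<in> N" for s
    using sum_w[OF that] by simp
qed

section \<open>Automorphisms fixing two points\<close>

lemma automorphism_fixing_two_points:
  assumes S: "4 \<le> card S" and \<tau>: "\<tau> \<in> Aut \<Omega> S"
    and xy: "x \<in> \<Omega>" "y \<in> \<Omega>" "x \<noteq> y" "\<tau> x = x" "\<tau> y = y"
  shows "\<tau> = id"
proof (rule ccontr)
  assume "\<tau> \<noteq> id"
  then obtain z where z: "\<tau> z \<noteq> z" by fastforce
  have perm: "\<tau> permutes \<Omega>" and aut: "\<And>a b. \<lbrakk>a \<in> \<Omega>; b \<in> \<Omega>\<rbrakk> \<Longrightarrow> r (\<tau> a) (\<tau> b) = r a b"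
    using \<tau> by (auto simp: Aut_def)
  have z\<Omega>: "z \<in> \<Omega>" "\<tau> z \<in> \<Omega>" using perm z permutes_not_in permutes_in_image by metis+
  define F where "F = {x \<in> \<Omega>. \<tau> x = x}"
  have F: "finite F" "x \<in> F" "y \<in> F" using finite_points xy by (auto simp: F_def)
  have "r z (\<tau> z) \<in> N" using r_N z\<Omega> z by metis
  then have "card F \<le> 3"
    using card_fixed_points_le[OF \<tau> z] sum_w_column_le unfolding F_def by (meson le_trans)
  then have F1: "card (F - {x, y}) \<le> 1" using F xy(3) by (simp add: card_Diff_subset)
  define s where "s = r x y"
  have s: "s \<in> N" "(x, y) \<in> s" unfolding s_def using r_N r_S mem_class_iff xy by blast+
  have large: "4 \<le> (\<Sum>v\<in>N. w q v * w s v)" if q: "q \<in> N" "q \<noteq> s" for q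
  proof -
    have yq: "y \<notin> nb x q" "x \<notin> nb x q"
      using mem_nb_r_iff[OF xy(1) N_S[OF q(1)]] mem_nb_iff[OF N_S[OF q(1)]] q(2) N_irrefl[OF q(1)] s_def
      by blast+
    \<comment> \<open>The fixed points \<open>x\<close> and \<open>y\<close> lie outside
      \<open>nb x q\<close>, which leaves at most one fixed point inside.\<close>
    have "card (nb x q \<inter> F) \<le> 1"
      using card_mono[of "F - {x, y}" "nb x q \<inter> F"] F F1 yq by force
    then have moved: "3 \<le> card (nb x q - F)"
      using card_Diff_subset_Int[of "nb x q" F] finite_nb card_nb[OF q(1) xy(1)] by simp
    \<comment> \<open>Both \<open>a\<close> and \<open>\<tau> a\<close> are middle points of paths
      from \<open>x\<close> to \<open>y\<close> through \<open>q\<close> and \<open>r a y\<close>,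
      and they differ when \<open>a\<close> is moved.\<close>
    have part: "1 + of_bool (a \<notin> F) \<le> c q (r a y) s" if a: "a \<in> nb x q" for a
    proof -
      let ?u = "r a y"
      have a\<Omega>: "a \<in> \<Omega>" "r x a = q" using a mem_nb_r_iff[OF xy(1) N_S[OF q(1)]] by auto
      have \<tau>a: "\<tau> a \<in> \<Omega>" "r x (\<tau> a) = q" "r (\<tau> a) y = ?u"
        using a\<Omega> aut[OF xy(1) a\<Omega>(1)] aut[OF a\<Omega>(1) xy(2)] xy perm by (simp_all add: permutes_in_image)
      have u: "?u \<in> S" using r_S a\<Omega> xy by blast
      have "{a, \<tau> a} \<subseteq> nb x q \<inter> nb y (?u\<inverse>)"
        using a\<Omega> \<tau>a xy u mem_class_iff N_S[OF q(1)] by (auto simp: nb_def)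
      then have "card {a, \<tau> a} \<le> c q ?u s"
        using card_paths[OF N_S[OF q(1)] u N_S[OF s(1)] s(2)] finite_nb by (metis card_mono finite_Int)
      then show ?thesis using a\<Omega>(1) by (cases "a \<in> F") (auto simp: F_def)
    qed
    have "4 + card (nb x q - F) = (\<Sum>a\<in>nb x q. 1 + of_bool (a \<notin> F))"
      using card_nb[OF q(1) xy(1)] finite_nb unfolding sum.distrib by (simp add: Diff_eq Compl_eq)
    also have "\<dots> \<le> (\<Sum>a\<in>nb x q. c q (r a y) s)" using part by (rule sum_mono)
    \<comment> \<open>Grouping by \<open>u = r a y\<close> weights each \<open>c q u s\<close> by
      itself, which produces the sum of squares; its 4 cancels against the left side.\<close>
    also have "\<dots> = 4 + (\<Sum>v\<in>N. w q v * w s v)"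
      using sum_c[OF q(1) s(1) q(2) s(2), of "\<lambda>u. c q u s"] sum_c_square[OF q(1) s(1) q(2)] by simp
    finally have "3 \<le> (\<Sum>v\<in>N. w q v * w s v)" using moved by simp
    moreover have "(\<Sum>v\<in>N. w q v * w s v) \<noteq> 3" using even_sum_w_mult[OF q(1) s(1) q(2)] by auto
    ultimately show ?thesis by simp
  qed
  \<comment> \<open>Besides the diagonal and \<open>s\<close> there are at least two classes,
    contributing 4 each.\<close>
  have "card N = card S - 1" using diagonal by (simp add: N_def)
  then have "2 \<le> card (N - {s})" using S s(1) by simp
  then have "8 \<le> (\<Sum>q\<in>N - {s}. 4 :: nat)" by simp
  also have "\<dots> \<le> (\<Sum>q\<in>N - {s}. \<Sum>v\<in>N. w q v * w s v)" using large by (intro sum_mono) auto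
  finally have others: "8 \<le> (\<Sum>q\<in>N - {s}. \<Sum>v\<in>N. w q v * w s v)" .
  \<comment> \<open>The term \<open>q = s\<close>: \<open>n \<le> n * n\<close> for natural numbers,
    and the row sum is 3.\<close>
  have "3 \<le> (\<Sum>v\<in>N. w s v * w s v)"
    using sum_mono[of N "w s" "\<lambda>v. w s v * w s v"] sum_w[OF s(1)] by simp
  then have "11 \<le> (\<Sum>q\<in>N. \<Sum>v\<in>N. w q v * w s v)"
    using others sum.remove[OF finite_N s(1), of "\<lambda>q. \<Sum>v\<in>N. w q v * w s v"] by simp
  also have "\<dots> = (\<Sum>v\<in>N. (\<Sum>q\<in>N. w q v) * w s v)"
    by (subst sum.swap) (simp add: sum_distrib_right)
  also have "\<dots> \<le> (\<Sum>v\<in>N. 3 * w s v)" using sum_w_column_le by (intro sum_mono mult_right_mono) auto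
  also have "\<dots> = 9" using sum_w[OF s(1)] by (simp add: sum_distrib_left[symmetric])
  finally show False by simp
qed

end

theorem theorem3p24:
  fixes \<Omega> :: "'a set" and S :: "('a \<times> 'a) set set" and \<tau> :: "'a \<Rightarrow> 'a" and \<alpha> \<beta> :: 'a
  assumes "association_scheme \<Omega> S"
    and "equivalenced 4 \<Omega> S"
    and "card S \<ge> 4"
    and "\<tau> \<in> Aut \<Omega> S"
    and "\<alpha> \<in> \<Omega>" and "\<beta> \<in> \<Omega>" and "\<alpha> \<noteq> \<beta>"
    and "\<tau> \<alpha> = \<alpha>" and "\<tau> \<beta> = \<beta>"
  shows "\<tau> = id"
proof -
  interpret association_scheme \<Omega> S by (rule assms(1))
  interpret four_equivalenced_scheme \<Omega> S by unfold_locales (use assms(2) in simp_all)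
  show ?thesis using assms(3-9) by (rule automorphism_fixing_two_points)
qed

end
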